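(* Let $n\ge 2$, let $\{e_{ij}\}_{1\le i<j\le n}\subset\mathbb{R}^d$ be observed edge feature vectors, and let $P_0,P_1$ be probability densities on $\mathbb{R}^d$, strictly positive at every observed $e_{ij}$. Let $L$, $\ell$, $G_0$, $C_{ij}$, $\Theta$ be the likelihood, log-likelihood, log-odds sign graph, edge costs and set of partitions defined in the context. Let $\theta_{MLE}\in\Theta$ be a maximizer of $L$ over $\Theta$, and let $$DIS=\min_{\theta\in\Theta}\ \sum_{i<j:\ \theta_{ij}\neq e_{0;ij}} C_{ij}.$$ Put $c_1 = 2+\frac{1}{\log(n+1)}$, and let $\hat\theta\in\Theta$ be the clustering returned by the $c_1\log(n)$-approximation algorithm for \textsc{MinimizeDisagreements} described in the context, run on $G_0$ with weights $C$. Then $\hat\theta$ is $c_1\, DIS\,\log(n)$-close to the log-likelihood of the maximum likelihood estimator: $$\ell(\theta_{MLE})-\ell(\hat\theta)\ \le\ c_1\, DIS\,\log(n),$$ and $\hat\theta$ is an $\exp\!\big(-DIS\,(c_1\log(n)-1)\big)$-approximation for the likelihood: $$\frac{L(\hat\theta)}{L(\theta_{MLE})}\ \ge\ \exp\!\big(-DIS\,(c_1\log(n)-1)\big).$$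
   Context: $\log$ is the natural logarithm. $\Theta$ is the set of all partitions of $\{1,\dots,n\}$ into disjoint clusters (any number of clusters). For $\theta\in\Theta$, $\theta_{ij}=1$ if $i$ and $j$ lie in the same cluster and $\theta_{ij}=0$ otherwise. Model (planted partition model with general edge features): given a partition, the edges are conditionally independent, $e_{ij}$ having density $P_1$ if $i,j$ are in the same cluster and $P_0$ otherwise. The likelihood of $\theta\in\Theta$ is $L(\theta)=\prod_{i<j}P_{\theta_{ij}}(e_{ij})$, and $\ell(\theta)=\log L(\theta)$. Log-odds sign graph $G_0$: the complete graph on $\{1,\dots,n\}$ with binary edge labels $e_{0;ij}$ given by the sign of $\log(P_1(e_{ij})/P_0(e_{ij}))$; a positive sign is identified with the label $1$ ("same cluster") and a negative sign with the label $0$ ("different clusters"); when the log-odds is $0$ the label may be chosen arbitrarily. The cost of mislabeling the edge $ij$ is $C_{ij}=\left|\log\left(P_1(e_{ij})/P_0(e_{ij})\right)\right|\ge 0$. \textsc{MinimizeDisagreements} (weighted correlation clustering) on $G_0$ with weights $C$: find $\theta\in\Theta$ minimizing $\sum_{i<j:\,\theta_{ij}\ne e_{0;ij}}C_{ij}$. So $DIS$ is its optimal value. The algorithm used is the LP-rounding (region-growing) algorithm of Demaine, Emanuel, Fiat and Immorlica (2006) for correlation clustering with arbitrary nonnegative weights. The guarantee taken from that work is that it is a $c_1\log(n)$-approximation algorithm, i.e. its output $\hat\theta\in\Theta$ satisfies $\sum_{i<j:\,\hat\theta_{ij}\ne e_{0;ij}}C_{ij}\le c_1\log(n)\,DIS$.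 *)

theory Defs
  imports "HOL-Probability.Probability" "HOL-Library.Disjoint_Sets"
begin

definition prob_density :: "(real ^ 'd \<Rightarrow> real) \<Rightarrow> bool" where
  "prob_density f \<longleftrightarrow>
     f \<in> borel_measurable borel \<and> (\<forall>x. 0 \<le> f x) \<and>
     prob_space (density lborel (\<lambda>x. ennreal (f x)))"

definition vertex_pairs :: "nat \<Rightarrow> (nat \<times> nat) set" where
  "vertex_pairs n = {(i, j). 1 \<le> i \<and> i < j \<and> j \<le> n}"

definition clusterings :: "nat \<Rightarrow> nat set set set" where
  "clusterings n = {\<theta>. partition_on {1..n} \<theta>}"

definition same_cluster :: "nat set set \<Rightarrow> nat \<Rightarrow> nat \<Rightarrow> nat" where
  "same_cluster \<theta> i j = (if \<exists>A\<in>\<theta>. i \<in> A \<and> j \<in> A then 1 else 0)"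

text \<open>The two densities are given as a family \<open>P\<close> indexed by the label, of which only
  \<open>P 0\<close> (different clusters) and \<open>P 1\<close> (same cluster) are relevant.  Edge features,
  labels and weights are functions of two vertices, used only at pairs in \<open>vertex_pairs n\<close>.\<close>

definition likelihood ::
    "(nat \<Rightarrow> real ^ 'd \<Rightarrow> real) \<Rightarrow> nat \<Rightarrow> (nat \<Rightarrow> nat \<Rightarrow> real ^ 'd) \<Rightarrow> nat set set \<Rightarrow> real" where
  "likelihood P n e \<theta> = (\<Prod>(i, j)\<in>vertex_pairs n. P (same_cluster \<theta> i j) (e i j))"

definition log_likelihood ::
    "(nat \<Rightarrow> real ^ 'd \<Rightarrow> real) \<Rightarrow> nat \<Rightarrow> (nat \<Rightarrow> nat \<Rightarrow> real ^ 'd) \<Rightarrow> nat set set \<Rightarrow> real" where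
  "log_likelihood P n e \<theta> = ln (likelihood P n e \<theta>)"

definition is_MLE ::
    "(nat \<Rightarrow> real ^ 'd \<Rightarrow> real) \<Rightarrow> nat \<Rightarrow> (nat \<Rightarrow> nat \<Rightarrow> real ^ 'd) \<Rightarrow> nat set set \<Rightarrow> bool" where
  "is_MLE P n e \<theta> \<longleftrightarrow> is_arg_max (likelihood P n e) (\<lambda>\<theta>. \<theta> \<in> clusterings n) \<theta>"

definition log_odds ::
    "(nat \<Rightarrow> real ^ 'd \<Rightarrow> real) \<Rightarrow> (nat \<Rightarrow> nat \<Rightarrow> real ^ 'd) \<Rightarrow> nat \<Rightarrow> nat \<Rightarrow> real" where
  "log_odds P e i j = ln (P 1 (e i j) / P 0 (e i j))"

definition edge_cost ::
    "(nat \<Rightarrow> real ^ 'd \<Rightarrow> real) \<Rightarrow> (nat \<Rightarrow> nat \<Rightarrow> real ^ 'd) \<Rightarrow> nat \<Rightarrow> nat \<Rightarrow> real" where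
  "edge_cost P e i j = \<bar>log_odds P e i j\<bar>"

text \<open>A predicate on labellings rather than a function, because the label of an edge with
  vanishing log-odds is arbitrary.\<close>

definition is_sign_graph ::
    "(nat \<Rightarrow> real ^ 'd \<Rightarrow> real) \<Rightarrow> nat \<Rightarrow> (nat \<Rightarrow> nat \<Rightarrow> real ^ 'd) \<Rightarrow> (nat \<Rightarrow> nat \<Rightarrow> nat) \<Rightarrow> bool" where
  "is_sign_graph P n e e0 \<longleftrightarrow>
     (\<forall>(i, j)\<in>vertex_pairs n. e0 i j \<in> {0, 1} \<and>
        (log_odds P e i j > 0 \<longrightarrow> e0 i j = 1) \<and>
        (log_odds P e i j < 0 \<longrightarrow> e0 i j = 0))"

definition disagreement ::
    "nat \<Rightarrow> (nat \<Rightarrow> nat \<Rightarrow> nat) \<Rightarrow> (nat \<Rightarrow> nat \<Rightarrow> real) \<Rightarrow> nat set set \<Rightarrow> real" where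
  "disagreement n e0 C \<theta> =
     (\<Sum>(i, j)\<in>{(i, j)\<in>vertex_pairs n. same_cluster \<theta> i j \<noteq> e0 i j}. C i j)"

definition min_disagreement ::
    "nat \<Rightarrow> (nat \<Rightarrow> nat \<Rightarrow> nat) \<Rightarrow> (nat \<Rightarrow> nat \<Rightarrow> real) \<Rightarrow> real" where
  "min_disagreement n e0 C = Min (disagreement n e0 C ` clusterings n)"

text \<open>The guarantee of a \<open>\<rho>\<close>-approximation algorithm for weighted correlation clustering,
  as a condition on the clustering it outputs on the instance with labels \<open>e0\<close> and weights \<open>C\<close>.\<close>

definition approx_minimizer ::
    "real \<Rightarrow> nat \<Rightarrow> (nat \<Rightarrow> nat \<Rightarrow> nat) \<Rightarrow> (nat \<Rightarrow> nat \<Rightarrow> real) \<Rightarrow> nat set set \<Rightarrow> bool" where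
  "approx_minimizer \<rho> n e0 C \<theta> \<longleftrightarrow>
     \<theta> \<in> clusterings n \<and> disagreement n e0 C \<theta> \<le> \<rho> * min_disagreement n e0 C"

end

theory Submission
  imports Defs
begin

text \<open>The labels of the sign graph choose the larger of the two densities on every edge, and
  mislabelling the edge \<open>ij\<close> lowers the log-likelihood by exactly the cost \<open>C i j\<close>.  Hence the
  log-likelihood of a clustering is a constant minus its disagreement, and the difference of two
  log-likelihoods is a difference of disagreements.\<close>

lemma finite_vertex_pairs: "finite (vertex_pairs n)"
proof (rule finite_subset)
  show "vertex_pairs n \<subseteq> {1..n} \<times> {1..n}"
    by (auto simp: vertex_pairs_def)
qed simp

lemma finite_clusterings: "finite (clusterings n)"
  unfolding clusterings_def by (rule finitely_many_partition_on) simp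

lemma same_cluster_in_01: "same_cluster \<theta> i j \<in> {0, 1}"
  by (simp add: same_cluster_def)

lemma disagreement_nonneg:
  assumes "\<And>i j. 0 \<le> C i j"
  shows "0 \<le> disagreement n e0 C \<theta>"
  unfolding disagreement_def by (rule sum_nonneg) (auto simp: assms)

lemma min_disagreement_le:
  assumes "\<theta> \<in> clusterings n"
  shows "min_disagreement n e0 C \<le> disagreement n e0 C \<theta>"
  unfolding min_disagreement_def using assms by (simp add: finite_clusterings)

text \<open>The hypothesis \<open>clusterings n \<noteq> {}\<close> keeps \<open>Min\<close> off the
  empty set, where its value is unspecified. In the theorem, the maximum likelihood estimator is a
  witness for it.\<close>

lemma min_disagreement_nonneg:
  assumes "clusterings n \<noteq> {}" and "\<And>i j. 0 \<le> C i j"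
  shows "0 \<le> min_disagreement n e0 C"
  unfolding min_disagreement_def
  using assms by (simp add: finite_clusterings disagreement_nonneg)

text \<open>Positivity is what allows passing back from log-likelihoods to likelihoods by
  \<open>exp\<close>. Assuming it for \<open>P 0\<close> and \<open>P 1\<close> suffices, since
  \<open>same_cluster\<close> takes no other values.\<close>

lemma likelihood_pos:
  assumes "\<And>i j. (i, j) \<in> vertex_pairs n \<Longrightarrow> P 0 (e i j) > 0 \<and> P 1 (e i j) > 0"
  shows "0 < likelihood P n e \<theta>"
  unfolding likelihood_def
proof (rule prod_pos, clarify)
  fix i j assume "(i, j) \<in> vertex_pairs n"
  with assms show "0 < P (same_cluster \<theta> i j) (e i j)"
    using same_cluster_in_01[of \<theta> i j] by fastforce
qed

text \<open>The wrong label replaces the larger density by the smaller one, so the loss is the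
  absolute log-odds. If the log-odds vanish, both densities agree and the cost is 0, so the
  arbitrary label does no harm.\<close>

lemma ln_density_eq:
  assumes "P 0 (e i j) > 0" and "P 1 (e i j) > 0"
    and "is_sign_graph P n e e0" and "(i, j) \<in> vertex_pairs n" and "t \<in> {0, 1}"
  shows "ln (P t (e i j)) =
    ln (P (e0 i j) (e i j)) - (if t \<noteq> e0 i j then edge_cost P e i j else 0)"
proof -
  have lo: "log_odds P e i j = ln (P 1 (e i j)) - ln (P 0 (e i j))"
    using assms(1,2) by (simp add: log_odds_def ln_div)
  have "e0 i j \<in> {0, 1}" "log_odds P e i j > 0 \<longrightarrow> e0 i j = 1" "log_odds P e i j < 0 \<longrightarrow> e0 i j = 0"
    using assms(3,4) by (auto simp: is_sign_graph_def)
  then show ?thesis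
    using assms(5) lo by (auto simp: edge_cost_def)
qed

text \<open>The first sum is the log-likelihood of the labelling \<open>e0\<close> itself, which
  need not come from any clustering. It does not depend on \<open>\<theta>\<close>, so it cancels
  when two clusterings are compared.\<close>

lemma log_likelihood_eq:
  assumes pos: "\<And>i j. (i, j) \<in> vertex_pairs n \<Longrightarrow> P 0 (e i j) > 0 \<and> P 1 (e i j) > 0"
    and sign: "is_sign_graph P n e e0"
  shows "log_likelihood P n e \<theta> =
    (\<Sum>(i, j)\<in>vertex_pairs n. ln (P (e0 i j) (e i j))) - disagreement n e0 (edge_cost P e) \<theta>"
proof -
  have "log_likelihood P n e \<theta> = (\<Sum>(i, j)\<in>vertex_pairs n. ln (P (same_cluster \<theta> i j) (e i j)))"
    unfolding log_likelihood_def likelihood_def case_prod_unfold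
  proof (rule ln_prod[OF finite_vertex_pairs])
    fix x assume "x \<in> vertex_pairs n"
    with pos[of "fst x" "snd x"] show "P (same_cluster \<theta> (fst x) (snd x)) (e (fst x) (snd x)) \<noteq> 0"
      using same_cluster_in_01[of \<theta> "fst x" "snd x"] by fastforce
  qed
  also have "\<dots> = (\<Sum>(i, j)\<in>vertex_pairs n. ln (P (e0 i j) (e i j)) -
      (if same_cluster \<theta> i j \<noteq> e0 i j then edge_cost P e i j else 0))"
    using pos by (intro sum.cong refl)
      (clarify, rule ln_density_eq[OF _ _ sign _ same_cluster_in_01], auto)
  also have "\<dots> = (\<Sum>(i, j)\<in>vertex_pairs n. ln (P (e0 i j) (e i j))) -
      (\<Sum>(i, j)\<in>vertex_pairs n. if same_cluster \<theta> i j \<noteq> e0 i j then edge_cost P e i j else 0)"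
    by (simp add: case_prod_unfold sum_subtractf)
  also have "(\<Sum>(i, j)\<in>vertex_pairs n. if same_cluster \<theta> i j \<noteq> e0 i j then edge_cost P e i j else 0)
      = disagreement n e0 (edge_cost P e) \<theta>"
    unfolding disagreement_def case_prod_unfold
    by (simp add: sum.inter_filter[OF finite_vertex_pairs])
  finally show ?thesis .
qed

theorem theorem1:
  fixes n :: nat
    and P :: "nat \<Rightarrow> real ^ 'd \<Rightarrow> real"
    and e :: "nat \<Rightarrow> nat \<Rightarrow> real ^ 'd"
    and e0 :: "nat \<Rightarrow> nat \<Rightarrow> nat"
    and C :: "nat \<Rightarrow> nat \<Rightarrow> real"
    and DIS c1 :: real
    and \<theta>_MLE \<theta>_hat :: "nat set set"
  assumes "n \<ge> 2"
    and "prob_density (P 0)" and "prob_density (P 1)"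
    and "\<And>i j. (i, j) \<in> vertex_pairs n \<Longrightarrow> P 0 (e i j) > 0 \<and> P 1 (e i j) > 0"
    and "is_sign_graph P n e e0"
    and "C = edge_cost P e"
    and "is_MLE P n e \<theta>_MLE"
    and "DIS = min_disagreement n e0 C"
    and "c1 = 2 + 1 / ln (real n + 1)"
    and "approx_minimizer (c1 * ln (real n)) n e0 C \<theta>_hat"
  shows "log_likelihood P n e \<theta>_MLE - log_likelihood P n e \<theta>_hat \<le> c1 * DIS * ln (real n)
    \<and> likelihood P n e \<theta>_hat / likelihood P n e \<theta>_MLE \<ge> exp (- DIS * (c1 * ln (real n) - 1))"
proof -
  let ?d = "disagreement n e0 C" and ?\<rho> = "c1 * ln (real n)"
  have MLE: "\<theta>_MLE \<in> clusterings n"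
    using assms(7) by (simp add: is_MLE_def is_arg_max_def)
  have hat: "?d \<theta>_hat \<le> ?\<rho> * DIS"
    using assms(8,10) by (simp add: approx_minimizer_def)
  have DIS_le: "DIS \<le> ?d \<theta>_MLE"
    using min_disagreement_le[OF MLE] assms(8) by simp
  have DIS_nonneg: "0 \<le> DIS"
    unfolding assms(6,8) by (rule min_disagreement_nonneg) (use MLE in \<open>auto simp: edge_cost_def\<close>)
  have "log_likelihood P n e \<theta>_MLE - log_likelihood P n e \<theta>_hat = ?d \<theta>_hat - ?d \<theta>_MLE"
    using log_likelihood_eq[OF assms(4,5)] assms(6) by simp
  \<comment> \<open>The \<open>- 1\<close> arises because the estimator itself disagrees with the
    sign graph by at least \<open>DIS\<close>. Both claims follow from this bound.\<close>
  then have gap: "log_likelihood P n e \<theta>_MLE - log_likelihood P n e \<theta>_hat \<le> DIS * (?\<rho> - 1)"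
    using hat DIS_le by (simp add: algebra_simps)
  have L_pos: "0 < likelihood P n e \<theta>" for \<theta>
    using assms(4) by (rule likelihood_pos)
  have "likelihood P n e \<theta>_hat / likelihood P n e \<theta>_MLE =
      exp (log_likelihood P n e \<theta>_hat - log_likelihood P n e \<theta>_MLE)"
    by (simp add: log_likelihood_def exp_diff L_pos)
  then have "exp (- DIS * (?\<rho> - 1)) \<le> likelihood P n e \<theta>_hat / likelihood P n e \<theta>_MLE"
    using gap by simp
  \<comment> \<open>The additive claim is the weaker one: it discards the term \<open>- DIS\<close>,
    which is at most 0.\<close>
  moreover have "DIS * (?\<rho> - 1) \<le> c1 * DIS * ln (real n)"
    using DIS_nonneg by (simp add: algebra_simps)
  ultimately show ?thesis
    using gap by simp
qed

end
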